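(* Let $\Omega\subset\mathbb{R}^d$ ($d=2,3$) be a bounded polyhedral domain, $\kappa\in\mathbb{R}$, $\sigma\in\mathbb{R}$, $\sigma>0$. Let $V_h$ be the first-order finite element space on a quasi-uniform triangulation of mesh size $h$, with nodal basis $\varphi_1,\dots,\varphi_n$, and let $A_{j,i}=a(\varphi_i,\varphi_j)$, $K_{j,i}=(\nabla\varphi_i,\nabla\varphi_j)$, $M_{j,i}=(\varphi_i,\varphi_j)$. Then there exist constants $c,C>0$, independent of $h$, $\sigma$ and $\kappa$, such that $$\mathcal{F}(AK^{-1}M)\subset\Big\{z\in\mathbb{C}:\ ch^d-\frac{\kappa^2}{\sigma}\Im z\le\Re z\le Ch^d-\frac{\kappa^2}{\sigma}\Im z\Big\}.$$
   Context: $a(u,v)=(\nabla u,\nabla v)-\kappa^2(u,v)+\mathrm{i}\sigma(u,v)$ with $(u,v)=\int_\Omega u\bar v$. $V_h=\{u\in H^1_0(\Omega): u|_T\in P_1(T)\ \forall T\}$. For $B\in\mathbb{C}^{n\times n}$, $\mathcal{F}(B)=\{x^*Bx/x^*x:\ x\in\mathbb{C}^n,\ x\neq0\}$. *)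

theory Defs
  imports "HOL-Analysis.Analysis"
begin

definition polyhedral_domain :: "(real^'d) set \<Rightarrow> bool" where
  "polyhedral_domain \<Omega> \<longleftrightarrow> open \<Omega> \<and> connected \<Omega> \<and> bounded \<Omega> \<and> \<Omega> \<noteq> {} \<and>
     (\<exists>P. finite P \<and> (\<forall>p\<in>P. polytope p) \<and> closure \<Omega> = \<Union>P) \<and>
     interior (closure \<Omega>) = \<Omega>"

text \<open>A conforming simplicial triangulation of the closure of \<Omega>, given as a finite set of
  cells, each cell represented by its vertex set (d+1 affinely independent points).\<close>
definition triangulation :: "(real^'d) set \<Rightarrow> (real^'d) set set \<Rightarrow> bool" where
  "triangulation \<Omega> T \<longleftrightarrow> finite T \<and>
     (\<forall>V\<in>T. finite V \<and> card V = CARD('d) + 1 \<and> \<not> affine_dependent V) \<and>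
     (\<forall>V\<in>T. \<forall>W\<in>T. convex hull V \<inter> convex hull W = convex hull (V \<inter> W)) \<and>
     \<Union>((\<lambda>V. convex hull V) ` T) = closure \<Omega>"

definition quasi_uniform_triangulation ::
  "(real^'d) set \<Rightarrow> real \<Rightarrow> real \<Rightarrow> (real^'d) set set \<Rightarrow> bool" where
  "quasi_uniform_triangulation \<Omega> \<rho> h T \<longleftrightarrow> triangulation \<Omega> T \<and> h > 0 \<and>
     (\<forall>V\<in>T. diameter (convex hull V) \<le> h \<and> (\<exists>x. ball x (\<rho> * h) \<subseteq> convex hull V))"

text \<open>V_h (real-valued): continuous, vanishing outside \<Omega> (hence on the boundary),
  affine on each cell.\<close>
definition P1_0 :: "(real^'d) set \<Rightarrow> (real^'d) set set \<Rightarrow> ((real^'d) \<Rightarrow> real) set" where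
  "P1_0 \<Omega> T = {u. continuous_on UNIV u \<and> (\<forall>x. x \<notin> \<Omega> \<longrightarrow> u x = 0) \<and>
     (\<forall>V\<in>T. \<exists>a b. \<forall>x\<in>convex hull V. u x = inner a x + b)}"

definition interior_nodes :: "(real^'d) set \<Rightarrow> (real^'d) set set \<Rightarrow> (real^'d) set" where
  "interior_nodes \<Omega> T = (\<Union>T) \<inter> \<Omega>"

definition hat :: "(real^'d) set \<Rightarrow> (real^'d) set set \<Rightarrow> real^'d \<Rightarrow> (real^'d \<Rightarrow> real)" where
  "hat \<Omega> T v = (THE u. u \<in> P1_0 \<Omega> T \<and>
     (\<forall>w\<in>interior_nodes \<Omega> T. u w = (if w = v then 1 else 0)))"

definition l2_inner :: "(real^'d) set \<Rightarrow> (real^'d \<Rightarrow> complex) \<Rightarrow> (real^'d \<Rightarrow> complex) \<Rightarrow> complex" where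
  "l2_inner \<Omega> u v = integral \<Omega> (\<lambda>x. u x * cnj (v x))"

text \<open>(\<nabla>u, \<nabla>v), with the gradient taken pointwise (a.e.) as the Frechet derivative.\<close>
definition grad_inner :: "(real^'d) set \<Rightarrow> (real^'d \<Rightarrow> complex) \<Rightarrow> (real^'d \<Rightarrow> complex) \<Rightarrow> complex" where
  "grad_inner \<Omega> u v = integral \<Omega> (\<lambda>x. \<Sum>k\<in>UNIV.
      frechet_derivative u (at x) (axis k 1) * cnj (frechet_derivative v (at x) (axis k 1)))"

definition a_form :: "real \<Rightarrow> real \<Rightarrow> (real^'d) set \<Rightarrow> (real^'d \<Rightarrow> complex) \<Rightarrow> (real^'d \<Rightarrow> complex) \<Rightarrow> complex" where
  "a_form \<kappa> \<sigma> \<Omega> u v = grad_inner \<Omega> u v - of_real (\<kappa>\<^sup>2) * l2_inner \<Omega> u v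
      + \<i> * of_real \<sigma> * l2_inner \<Omega> u v"

section \<open>n x n matrices as functions on indices, with indices < n relevant\<close>

definition mat_mul :: "nat \<Rightarrow> (nat \<Rightarrow> nat \<Rightarrow> complex) \<Rightarrow> (nat \<Rightarrow> nat \<Rightarrow> complex) \<Rightarrow> (nat \<Rightarrow> nat \<Rightarrow> complex)" where
  "mat_mul n A B = (\<lambda>j i. if j < n \<and> i < n then (\<Sum>k<n. A j k * B k i) else 0)"

definition mat_inv :: "nat \<Rightarrow> (nat \<Rightarrow> nat \<Rightarrow> complex) \<Rightarrow> (nat \<Rightarrow> nat \<Rightarrow> complex)" where
  "mat_inv n A = (THE B. (\<forall>j i. \<not> (j < n \<and> i < n) \<longrightarrow> B j i = 0) \<and>
     (\<forall>j<n. \<forall>i<n. (\<Sum>k<n. A j k * B k i) = (if j = i then 1 else 0)) \<and>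
     (\<forall>j<n. \<forall>i<n. (\<Sum>k<n. B j k * A k i) = (if j = i then 1 else 0)))"

definition field_of_values :: "nat \<Rightarrow> (nat \<Rightarrow> nat \<Rightarrow> complex) \<Rightarrow> complex set" where
  "field_of_values n B = {(\<Sum>j<n. cnj (x j) * (\<Sum>i<n. B j i * x i)) / (\<Sum>j<n. cnj (x j) * x j)
     | x. \<exists>j<n. x j \<noteq> 0}"

section \<open>FEM matrices for a numbering nd of the interior nodes\<close>

definition basis_fn :: "(real^'d) set \<Rightarrow> (real^'d) set set \<Rightarrow> (nat \<Rightarrow> real^'d) \<Rightarrow> nat \<Rightarrow> (real^'d \<Rightarrow> complex)" where
  "basis_fn \<Omega> T nd i = (\<lambda>x. complex_of_real (hat \<Omega> T (nd i) x))"

definition stiff_mat :: "(real^'d) set \<Rightarrow> (real^'d) set set \<Rightarrow> (nat \<Rightarrow> real^'d) \<Rightarrow> (nat \<Rightarrow> nat \<Rightarrow> complex)" where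
  "stiff_mat \<Omega> T nd = (\<lambda>j i. grad_inner \<Omega> (basis_fn \<Omega> T nd i) (basis_fn \<Omega> T nd j))"

definition mass_mat :: "(real^'d) set \<Rightarrow> (real^'d) set set \<Rightarrow> (nat \<Rightarrow> real^'d) \<Rightarrow> (nat \<Rightarrow> nat \<Rightarrow> complex)" where
  "mass_mat \<Omega> T nd = (\<lambda>j i. l2_inner \<Omega> (basis_fn \<Omega> T nd i) (basis_fn \<Omega> T nd j))"

definition sys_mat :: "real \<Rightarrow> real \<Rightarrow> (real^'d) set \<Rightarrow> (real^'d) set set \<Rightarrow> (nat \<Rightarrow> real^'d) \<Rightarrow> (nat \<Rightarrow> nat \<Rightarrow> complex)" where
  "sys_mat \<kappa> \<sigma> \<Omega> T nd = (\<lambda>j i. a_form \<kappa> \<sigma> \<Omega> (basis_fn \<Omega> T nd i) (basis_fn \<Omega> T nd j))"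

end

theory Submission
  imports Defs "Jordan_Normal_Form.Determinant"
begin

text \<open>Since \<open>A = K + (i \<sigma> - \<kappa>\<^sup>2) M\<close>, we have \<open>A K\<^sup>-\<^sup>1 M = M + (i \<sigma> - \<kappa>\<^sup>2) M K\<^sup>-\<^sup>1 M\<close>, and the
  quadratic forms of \<open>M\<close> and \<open>M K\<^sup>-\<^sup>1 M\<close> are real. Hence \<open>Re z + \<kappa>\<^sup>2 / \<sigma> * Im z\<close> is the Rayleigh
  quotient of \<open>M\<close>, and the theorem is the classical estimate that this quotient is of order \<open>h^d\<close>.
  The upper bound follows from \<open>|u|\<^sup>2 \<le> \<Sum> |x\<^sub>i|\<^sup>2 \<phi>\<^sub>i\<close> (the hat functions are nonnegative with sum at
  most 1) and the fact that \<open>\<phi>\<^sub>i\<close> lives in a ball of radius \<open>h\<close>. For the lower bound, in each cell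
  the inscribed ball is shrunk by the factor 1/4 towards the vertex where \<open>|u|\<close> is largest; on the
  shrunk ball \<open>|u|\<close> is at least half of that maximum, and the balls of different cells are disjoint.\<close>

section \<open>Inverses and quadratic forms of index-function matrices\<close>

text \<open>This is the predicate under the \<open>THE\<close> in \<open>mat_inv\<close>. The zero
  padding outside the n by n block makes the inverse unique as a function.\<close>

definition is_mat_inv :: "nat \<Rightarrow> (nat \<Rightarrow> nat \<Rightarrow> complex) \<Rightarrow> (nat \<Rightarrow> nat \<Rightarrow> complex) \<Rightarrow> bool" where
  "is_mat_inv n A B \<longleftrightarrow> (\<forall>j i. \<not> (j < n \<and> i < n) \<longrightarrow> B j i = 0) \<and>
     (\<forall>j<n. \<forall>i<n. (\<Sum>k<n. A j k * B k i) = (if j = i then 1 else 0)) \<and>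
     (\<forall>j<n. \<forall>i<n. (\<Sum>k<n. B j k * A k i) = (if j = i then 1 else 0))"

text \<open>Inside the block, B = B (A C) = (B A) C = C; outside it the padding decides.\<close>

lemma is_mat_inv_unique:
  assumes "is_mat_inv n A B" "is_mat_inv n A C"
  shows "B = C"
proof (intro ext)
  fix j i
  show "B j i = C j i"
  proof (cases "j < n \<and> i < n")
    case True
    have "B j i = (\<Sum>k<n. B j k * (\<Sum>l<n. A k l * C l i))"
      using assms True by (simp add: is_mat_inv_def if_distrib[of "\<lambda>x. _ * x"] cong: if_cong)
    also have "\<dots> = (\<Sum>l<n. (\<Sum>k<n. B j k * A k l) * C l i)"
      unfolding sum_distrib_left sum_distrib_right
      by (subst sum.swap) (simp add: mult.assoc)
    also have "\<dots> = C j i"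
      using assms True by (simp add: is_mat_inv_def if_distrib[of "\<lambda>x. x * _"] cong: if_cong)
    finally show ?thesis .
  next
    case False
    then show ?thesis using assms by (simp add: is_mat_inv_def)
  qed
qed

lemma mat_inv_eqI:
  assumes "is_mat_inv n A B" shows "mat_inv n A = B"
  unfolding mat_inv_def using assms is_mat_inv_unique
  by (intro the_equality) (auto simp: is_mat_inv_def)

text \<open>A trivial kernel means a nonzero determinant, so the block is a unit of the matrix ring;
  its inverse, padded by zeros, is the witness. Only then does the \<open>THE\<close> in
  \<open>mat_inv\<close> denote an inverse.\<close>

lemma is_mat_inv_mat_inv:
  assumes ker: "\<And>x. (\<And>j. j < n \<Longrightarrow> (\<Sum>i<n. A j i * x i) = 0) \<Longrightarrow> (\<And>i. i < n \<Longrightarrow> x i = 0)"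
  shows "is_mat_inv n A (mat_inv n A)"
proof -
  define M where "M = Matrix.mat n n (\<lambda>(j,i). A j i)"
  have M: "M \<in> carrier_mat n n" by (simp add: M_def)
  have "Determinant.det M \<noteq> 0"
  proof
    assume "Determinant.det M = 0"
    then obtain v where v: "v \<in> carrier_vec n" "v \<noteq> 0\<^sub>v n" "M *\<^sub>v v = 0\<^sub>v n"
      using det_0_iff_vec_prod_zero_field[OF M] by auto
    have "(\<Sum>i<n. A j i * vec_index v i) = 0" if "j < n" for j
    proof -
      have "vec_index (M *\<^sub>v v) j = 0" using v that by simp
      then show ?thesis using v that
        by (auto simp: M_def scalar_prod_def atLeast0LessThan)
    qed
    then have "vec_index v i = 0" if "i < n" for i using ker[of "vec_index v"] that by blast
    then have "v = 0\<^sub>v n" using v(1) by (intro eq_vecI) auto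
    then show False using v by simp
  qed
  \<comment> \<open>The \<open>()\<close> fills the extension slot of the matrix ring
    record.\<close>
  from det_non_zero_imp_unit[OF M this, of "()"]
  obtain N where N: "N \<in> carrier_mat n n" "N * M = 1\<^sub>m n" "M * N = 1\<^sub>m n"
    by (auto simp: Units_def ring_mat_def)
  define B where "B = (\<lambda>j i. if j < n \<and> i < n then index_mat N (j,i) else 0)"
  have "(\<Sum>k<n. A j k * B k i) = (if j = i then 1 else 0)" if "j < n" "i < n" for j i
  proof -
    have "index_mat (M * N) (j,i) = (if j = i then 1 else 0)" using N that by simp
    moreover have "index_mat (M * N) (j,i) = (\<Sum>k<n. A j k * B k i)"
      using N(1) that by (simp add: M_def B_def scalar_prod_def atLeast0LessThan)
    ultimately show ?thesis by simp
  qed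
  moreover have "(\<Sum>k<n. B j k * A k i) = (if j = i then 1 else 0)" if "j < n" "i < n" for j i
  proof -
    have "index_mat (N * M) (j,i) = (if j = i then 1 else 0)" using N that by simp
    moreover have "index_mat (N * M) (j,i) = (\<Sum>k<n. B j k * A k i)"
      using N(1) that by (simp add: M_def B_def scalar_prod_def atLeast0LessThan)
    ultimately show ?thesis by simp
  qed
  ultimately have "is_mat_inv n A B"
    unfolding is_mat_inv_def by (auto simp: B_def)
  then show ?thesis using mat_inv_eqI by metis
qed

text \<open>The conjugate transpose of an inverse of a Hermitian matrix is again an inverse of it,
  so uniqueness identifies the two.\<close>

lemma hermitian_mat_inv:
  assumes A: "\<And>i j. A i j = cnj (A j i)" and B: "is_mat_inv n A B"
  shows "B i j = cnj (B j i)"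
proof -
  have "is_mat_inv n A (\<lambda>i j. cnj (B j i))"
    unfolding is_mat_inv_def
  proof (intro conjI allI impI)
    fix j i assume "j < n" "i < n"
    have "(\<Sum>k<n. A j k * cnj (B i k)) = cnj (\<Sum>k<n. B i k * A k j)"
      unfolding cnj_sum by (intro sum.cong refl) (metis A complex_cnj_mult mult.commute)
    then show "(\<Sum>k<n. A j k * cnj (B i k)) = (if j = i then 1 else 0)"
      using B \<open>j < n\<close> \<open>i < n\<close> by (simp add: is_mat_inv_def del: cnj_sum)
    have "(\<Sum>k<n. cnj (B k j) * A k i) = cnj (\<Sum>k<n. A i k * B k j)"
      unfolding cnj_sum by (intro sum.cong refl) (metis A complex_cnj_mult mult.commute)
    then show "(\<Sum>k<n. cnj (B k j) * A k i) = (if j = i then 1 else 0)"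
      using B \<open>j < n\<close> \<open>i < n\<close> by (simp add: is_mat_inv_def del: cnj_sum)
  qed (use B in \<open>auto simp: is_mat_inv_def\<close>)
  from is_mat_inv_unique[OF B this] show ?thesis by metis
qed

section \<open>Quadratic forms and the field of values\<close>

text \<open>The form x^* B x, the numerator of the Rayleigh quotient.\<close>

definition sesq :: "nat \<Rightarrow> (nat \<Rightarrow> nat \<Rightarrow> complex) \<Rightarrow> (nat \<Rightarrow> complex) \<Rightarrow> complex" where
  "sesq n B x = (\<Sum>j<n. cnj (x j) * (\<Sum>i<n. B j i * x i))"

lemma sesq_hermitian_real:
  assumes "\<And>i j. B i j = cnj (B j i)"
  shows "Im (sesq n B x) = 0"
proof -
  have "cnj (sesq n B x) = (\<Sum>j<n. \<Sum>i<n. x j * cnj (B j i) * cnj (x i))"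
    by (simp add: sesq_def sum_distrib_left mult.assoc)
  also have "\<dots> = (\<Sum>i<n. \<Sum>j<n. cnj (x i) * B i j * x j)"
    by (subst sum.swap) (intro sum.cong refl, simp add: assms[symmetric] mult_ac)
  also have "\<dots> = sesq n B x"
    by (simp add: sesq_def sum_distrib_left mult.assoc)
  finally show ?thesis
    by (simp add: complex_eq_iff)
qed

lemma norm_power2_sum_complex: "(\<Sum>j<n. cnj (x j) * x j) = of_real (\<Sum>j<n. (cmod (x j))\<^sup>2)"
  by (simp add: complex_norm_square[symmetric] mult.commute del: of_real_power)

text \<open>With \<open>y\<close> = M x, \<open>N\<close> = |x|^2, m = x^* M x and q = y^* K^-1 y
  one gets z N = m + (i \<sigma> - \<kappa>^2) q. As m and q are real, the imaginary part gives q =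
  N Im z / \<sigma>, and eliminating q from the real part leaves m.\<close>

lemma field_of_values_shifted:
  assumes K: "\<And>i j. K i j = cnj (K j i)" and M: "\<And>i j. M i j = cnj (M j i)"
    and inv: "is_mat_inv n K (mat_inv n K)"
    and S: "\<And>j i. S j i = K j i - of_real (\<kappa>\<^sup>2) * M j i + \<i> * of_real \<sigma> * M j i"
    and sig: "\<sigma> > 0"
    and z: "z \<in> field_of_values n (mat_mul n (mat_mul n S (mat_inv n K)) M)"
  obtains x where "(\<Sum>j<n. (cmod (x j))\<^sup>2) > 0"
    "(Re z + \<kappa>\<^sup>2 / \<sigma> * Im z) * (\<Sum>j<n. (cmod (x j))\<^sup>2) = Re (sesq n M x)"
proof -
  define B where "B = mat_inv n K"
  define s where "s = \<i> * of_real \<sigma> - complex_of_real (\<kappa>\<^sup>2)"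
  define X where "X = mat_mul n (mat_mul n S B) M"
  obtain x j0 where x: "j0 < n" "x j0 \<noteq> 0"
    and zx: "z = sesq n X x / (\<Sum>j<n. cnj (x j) * x j)"
    using z unfolding field_of_values_def sesq_def X_def B_def by auto
  define N where "N = (\<Sum>j<n. (cmod (x j))\<^sup>2)"
  have N: "N > 0" unfolding N_def using x by (intro sum_pos2[of _ j0]) auto
  define y where "y = (\<lambda>k. \<Sum>i<n. M k i * x i)"
  \<comment> \<open>S K^-1 = I + s M K^-1, entry by entry.\<close>
  have SB: "(\<Sum>k<n. S j k * B k l) = (if j = l then 1 else 0) + s * (\<Sum>k<n. M j k * B k l)"
    if "j < n" "l < n" for j l
  proof -
    have "(\<Sum>k<n. S j k * B k l) = (\<Sum>k<n. K j k * B k l) + s * (\<Sum>k<n. M j k * B k l)"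
      unfolding S s_def sum_distrib_left sum.distrib[symmetric]
      by (intro sum.cong refl) (simp add: algebra_simps)
    then show ?thesis using inv that by (simp add: is_mat_inv_def B_def)
  qed
  have Xx: "(\<Sum>i<n. X j i * x i) = y j + s * (\<Sum>k<n. M j k * (\<Sum>l<n. B k l * y l))" if "j < n" for j
  proof -
    have "(\<Sum>i<n. X j i * x i) = (\<Sum>i<n. \<Sum>l<n. (\<Sum>k<n. S j k * B k l) * M l i * x i)"
      using that by (intro sum.cong refl) (simp add: X_def mat_mul_def sum_distrib_right)
    also have "\<dots> = (\<Sum>l<n. (\<Sum>k<n. S j k * B k l) * y l)"
      unfolding y_def by (subst sum.swap) (simp add: sum_distrib_left mult.assoc)
    also have "\<dots> = (\<Sum>l<n. (if j = l then y l else 0) + s * (\<Sum>k<n. M j k * B k l) * y l)"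
      using SB that by (intro sum.cong refl) (simp add: algebra_simps)
    also have "\<dots> = y j + (\<Sum>l<n. s * (\<Sum>k<n. M j k * B k l) * y l)"
      using that by (simp add: sum.distrib)
    also have "(\<Sum>l<n. s * (\<Sum>k<n. M j k * B k l) * y l) = s * (\<Sum>l<n. \<Sum>k<n. M j k * (B k l * y l))"
      by (simp add: sum_distrib_left sum_distrib_right mult.assoc)
    also have "(\<Sum>l<n. \<Sum>k<n. M j k * (B k l * y l)) = (\<Sum>k<n. M j k * (\<Sum>l<n. B k l * y l))"
      by (subst sum.swap) (simp add: sum_distrib_left)
    finally show ?thesis .
  qed
  have "sesq n X x = sesq n M x + s * sesq n B y"
  proof -
    have "sesq n X x = (\<Sum>j<n. cnj (x j) * y j) +
        s * (\<Sum>j<n. \<Sum>k<n. cnj (x j) * M j k * (\<Sum>l<n. B k l * y l))"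
      by (simp add: sesq_def Xx distrib_left sum.distrib)
         (simp add: sum_distrib_left mult_ac)
    also have "(\<Sum>j<n. \<Sum>k<n. cnj (x j) * M j k * (\<Sum>l<n. B k l * y l))
      = (\<Sum>k<n. (\<Sum>j<n. cnj (x j) * M j k) * (\<Sum>l<n. B k l * y l))"
      by (subst sum.swap) (simp add: sum_distrib_right)
    also have "\<dots> = (\<Sum>k<n. cnj (y k) * (\<Sum>l<n. B k l * y l))"
    proof -
      \<comment> \<open>Since M is Hermitian, x^* M is the conjugate transpose of M x.\<close>
      have "(\<Sum>j<n. cnj (x j) * M j k) = cnj (y k)" for k
        unfolding y_def cnj_sum by (intro sum.cong refl) (metis M complex_cnj_mult mult.commute)
      then show ?thesis by simp
    qed
    finally show ?thesis by (simp add: sesq_def y_def)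
  qed
  then have "z * of_real N = sesq n M x + s * sesq n B y"
    using N unfolding zx norm_power2_sum_complex N_def[symmetric] by simp
  moreover have "Im (sesq n B y) = 0"
    unfolding B_def using inv by (intro sesq_hermitian_real hermitian_mat_inv[OF K])
  moreover have "Im (sesq n M x) = 0"
    by (intro sesq_hermitian_real M)
  ultimately have "Re z * N = Re (sesq n M x) - \<kappa>\<^sup>2 * Re (sesq n B y)"
    and "Re (sesq n B y) = Im z * N / \<sigma>"
    using sig by (auto simp: complex_eq_iff s_def)
  then have "(Re z + \<kappa>\<^sup>2 / \<sigma> * Im z) * N = Re (sesq n M x)"
    using sig by (simp add: algebra_simps)
  then show ?thesis using that N N_def by blast
qed

section \<open>Barycentric coordinates\<close>

text \<open>After translating one vertex to the origin the remaining vertices are linearly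
  independent, so a linear functional with prescribed values there exists; it is then written as an
  inner product.\<close>

lemma affine_interpolation:
  fixes V :: "(real^'d) set" and f :: "real^'d \<Rightarrow> real"
  assumes "\<not> affine_dependent V"
  shows "\<exists>a b. \<forall>w\<in>V. inner a w + b = f w"
proof (cases "V = {}")
  case False
  then obtain v0 where v0: "v0 \<in> V" by auto
  have "independent ((\<lambda>x. - v0 + x) ` (V - {v0}))"
    using assms v0 by (simp add: affine_dependent_iff_dependent2)
  then obtain g :: "real^'d \<Rightarrow> real" where g: "linear g"
    and gf: "\<And>x. x \<in> (\<lambda>x. - v0 + x) ` (V - {v0}) \<Longrightarrow> g x = f (v0 + x) - f v0"
    using linear_independent_extend[of "(\<lambda>x. - v0 + x) ` (V - {v0})" "\<lambda>x. f (v0 + x) - f v0"] by blast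
  have rep: "g x = inner (\<Sum>i\<in>Basis. g i *\<^sub>R i) x" for x
  proof -
    have "g x = g (\<Sum>i\<in>Basis. inner x i *\<^sub>R i)" by (simp add: euclidean_representation)
    also have "\<dots> = (\<Sum>i\<in>Basis. inner x i * g i)"
      by (simp add: linear_sum[OF g] linear_scale[OF g])
    finally show ?thesis by (simp add: inner_sum_left inner_commute[of x] mult.commute)
  qed
  have "inner (\<Sum>i\<in>Basis. g i *\<^sub>R i) w + (f v0 - g v0) = f w" if "w \<in> V" for w
  proof (cases "w = v0")
    case False
    then have "g (- v0 + w) = f w - f v0" using gf[of "- v0 + w"] that by auto
    then show ?thesis unfolding rep[symmetric] using linear_diff[OF g, of w v0] by simp
  qed (simp add: rep[symmetric])
  then show ?thesis by blast
qed simp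

text \<open>The barycentric coordinate of \<open>v\<close>, taken as an affine function on the whole
  space rather than on the simplex. \<open>v\<close> may lie outside \<open>V\<close>; all vertex
  values are then 0, which matches a hat function on cells away from its node.\<close>

definition bary :: "(real^'d) set \<Rightarrow> real^'d \<Rightarrow> real^'d \<Rightarrow> real" where
  "bary V v = (SOME f. (\<exists>a b. f = (\<lambda>x. inner a x + b)) \<and> (\<forall>w\<in>V. f w = (if w = v then 1 else 0)))"

text \<open>The points where two affine functions agree form a convex set.\<close>

lemma affine_eq_on_hull:
  fixes a a' :: "'a::real_inner"
  assumes "\<And>w. w \<in> S \<Longrightarrow> inner a w + b = inner a' w + b'" "x \<in> convex hull S"
  shows "inner a x + b = inner a' x + b'"
proof -
  have "S \<subseteq> {x. inner (a - a') x = b' - b}" using assms(1) by (force simp: inner_diff_left)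
  then have "convex hull S \<subseteq> {x. inner (a - a') x = b' - b}"
    by (rule hull_minimal) (rule convex_hyperplane)
  then show ?thesis using assms(2) by (auto simp: inner_diff_left)
qed

lemma affine_sum:
  assumes "sum u V = 1"
  shows "inner a (\<Sum>w\<in>V. u w *\<^sub>R w) + b = (\<Sum>w\<in>V. u w * (inner a w + b))"
proof -
  have "(\<Sum>w\<in>V. u w * (inner a w + b)) = (\<Sum>w\<in>V. u w * inner a w) + sum u V * b"
    by (simp add: distrib_left sum.distrib sum_distrib_right)
  then show ?thesis using assms by (simp add: inner_sum_right)
qed

locale full_simplex =
  fixes V :: "(real^'d) set"
  assumes fin: "finite V" and card: "card V = CARD('d) + 1" and indep: "\<not> affine_dependent V"
begin

lemma bary_spec: "(\<exists>a b. bary V v = (\<lambda>x. inner a x + b)) \<and> (\<forall>w\<in>V. bary V v w = (if w = v then 1 else 0))"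
proof -
  obtain a b where "\<forall>w\<in>V. inner a w + b = (if w = v then 1 else (0::real))"
    using affine_interpolation[OF indep, of "\<lambda>w. if w = v then 1 else 0"] by blast
  then have "\<exists>f. (\<exists>a b. f = (\<lambda>x. inner a x + b)) \<and> (\<forall>w\<in>V. f w = (if w = v then 1 else (0::real)))"
    by (intro exI[of _ "\<lambda>x. inner a x + b"]) auto
  then show ?thesis unfolding bary_def by (rule someI_ex)
qed

lemma bary_affine: obtains a b where "\<And>x. bary V v x = inner a x + b"
  using bary_spec[of v] by metis

lemma bary_vertex: "w \<in> V \<Longrightarrow> bary V v w = (if w = v then 1 else 0)"
  using bary_spec[of v] by blast

lemma bary_sum:
  assumes "sum u V = 1" "v \<in> V"
  shows "bary V v (\<Sum>w\<in>V. u w *\<^sub>R w) = u v"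
proof -
  obtain a b where ab: "\<And>x. bary V v x = inner a x + b" using bary_affine[of v] by metis
  have "bary V v (\<Sum>w\<in>V. u w *\<^sub>R w) = (\<Sum>w\<in>V. u w * bary V v w)"
    unfolding ab by (rule affine_sum[OF assms(1)])
  also have "\<dots> = (\<Sum>w\<in>V. if w = v then u w else 0)"
    by (intro sum.cong refl) (simp add: bary_vertex)
  finally show ?thesis using assms fin by simp
qed

lemma affine_hull_UNIV: "affine hull V = UNIV"
  using indep card by (intro affine_independent_span_eq) auto

text \<open>Valid at every point of the space, because d+1 affinely independent points have the
  whole space as affine hull.\<close>

lemma bary_repr: "(\<Sum>w\<in>V. bary V w x) = 1" "(\<Sum>w\<in>V. bary V w x *\<^sub>R w) = x"
proof -
  have "x \<in> affine hull V" by (simp add: affine_hull_UNIV)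
  then obtain u where u: "sum u V = 1" "(\<Sum>w\<in>V. u w *\<^sub>R w) = x"
    unfolding affine_hull_finite[OF fin] by auto
  have "bary V w x = u w" if "w \<in> V" for w using bary_sum[OF u(1) that] u(2) by simp
  then show "(\<Sum>w\<in>V. bary V w x) = 1" "(\<Sum>w\<in>V. bary V w x *\<^sub>R w) = x" using u by auto
qed

lemma hull_iff_bary: "x \<in> convex hull V \<longleftrightarrow> (\<forall>w\<in>V. bary V w x \<ge> 0)"
proof
  assume "x \<in> convex hull V"
  then obtain u where u: "\<forall>w\<in>V. u w \<ge> 0" "sum u V = 1" "(\<Sum>w\<in>V. u w *\<^sub>R w) = x"
    unfolding convex_hull_finite[OF fin] by auto
  then show "\<forall>w\<in>V. bary V w x \<ge> 0" using bary_sum[OF u(2)] by simp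
next
  assume "\<forall>w\<in>V. bary V w x \<ge> 0"
  then show "x \<in> convex hull V"
    unfolding convex_hull_finite[OF fin] using bary_repr[of x]
    by (intro CollectI exI[of _ "\<lambda>w. bary V w x"]) auto
qed

lemma affine_bary: "inner a x + b = (\<Sum>w\<in>V. bary V w x * (inner a w + b))"
  using affine_sum[OF bary_repr(1), of a x b] by (simp add: bary_repr)

text \<open>On \<open>S\<close> the coordinate has the vertex values of the zero function. This
  serves both for a face opposite to \<open>v\<close> and, with \<open>S\<close> = \<open>V\<close>,
  for a point \<open>v\<close> that is no vertex of the simplex.\<close>

lemma bary_zero:
  assumes "x \<in> convex hull S" "S \<subseteq> V" "v \<notin> S"
  shows "bary V v x = 0"
proof -
  obtain a b where ab: "\<And>x. bary V v x = inner a x + b" using bary_affine[of v] by metis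
  have "inner a x + b = inner 0 x + 0"
    by (rule affine_eq_on_hull[OF _ assms(1)])
       (use assms bary_vertex[of _ v, unfolded ab] in auto)
  then show ?thesis by (simp add: ab)
qed

lemma bary_le_1:
  assumes "x \<in> convex hull V" shows "bary V v x \<le> 1"
proof (cases "v \<in> V")
  case True
  have "bary V v x \<le> (\<Sum>w\<in>V. bary V w x)"
    by (rule member_le_sum) (use assms True fin hull_iff_bary in auto)
  then show ?thesis by (simp add: bary_repr)
next
  case False
  then show ?thesis using bary_zero[OF assms] by simp
qed

lemma hull_subset_bary:
  assumes "S \<subseteq> V" "x \<in> convex hull V" "\<And>w. w \<in> V - S \<Longrightarrow> bary V w x = 0"
  shows "x \<in> convex hull S"
proof -
  have finS: "finite S" using assms fin finite_subset by auto
  have "(\<Sum>w\<in>S. bary V w x) = (\<Sum>w\<in>V. bary V w x)"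
    using assms fin by (intro sum.mono_neutral_left) auto
  moreover have "(\<Sum>w\<in>S. bary V w x *\<^sub>R w) = (\<Sum>w\<in>V. bary V w x *\<^sub>R w)"
    using assms fin by (intro sum.mono_neutral_left) auto
  ultimately show ?thesis
    unfolding convex_hull_finite[OF finS] using assms hull_iff_bary bary_repr[of x]
    by (intro CollectI exI[of _ "\<lambda>w. bary V w x"]) auto
qed

text \<open>Affine functions under the dilation with centre \<open>v\<close> and factor
  \<open>t\<close>. Coordinates of the other vertices are just multiplied by \<open>t\<close>, which
  drives both the open star argument and the shrinking of inscribed balls.\<close>

lemma bary_scaled:
  assumes "w \<in> V" "v \<in> V"
  shows "bary V w (v + t *\<^sub>R (x - v)) = (1 - t) * (if v = w then 1 else 0) + t * bary V w x"
proof -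
  obtain a b where ab: "\<And>x. bary V w x = inner a x + b" using bary_affine[of w] by metis
  have "bary V w (v + t *\<^sub>R (x - v)) = (1 - t) * bary V w v + t * bary V w x"
    by (simp add: ab inner_add_right inner_diff_right algebra_simps)
  then show ?thesis using bary_vertex[OF assms(2), of w] by simp
qed

lemma continuous_on_bary: "continuous_on A (bary V v)"
proof -
  obtain a b where ab: "\<And>x. bary V v x = inner a x + b" using bary_affine[of v] by metis
  then have "bary V v = (\<lambda>x. inner a x + b)" by auto
  then show ?thesis by (auto intro!: continuous_intros)
qed

lemma closed_hull: "closed (convex hull V)"
  using fin by (simp add: compact_imp_closed finite_imp_compact_convex_hull)

end

text \<open>Both coordinates have the same values at the common vertices. With conformity of the
  mesh this makes piecewise barycentric functions well defined across cells.\<close>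

lemma bary_agree:
  assumes "full_simplex V" "full_simplex W" "x \<in> convex hull (V \<inter> W)"
  shows "bary V v x = bary W v x"
proof -
  interpret V: full_simplex V by fact
  interpret W: full_simplex W by fact
  obtain a b where ab: "\<And>x. bary V v x = inner a x + b" using V.bary_affine[of v] by metis
  obtain a' b' where ab': "\<And>x. bary W v x = inner a' x + b'" using W.bary_affine[of v] by metis
  show ?thesis unfolding ab ab'
    by (rule affine_eq_on_hull[OF _ assms(3)])
       (use V.bary_vertex[of _ v, unfolded ab] W.bary_vertex[of _ v, unfolded ab'] in auto)
qed

section \<open>Hat functions of a triangulation\<close>

locale fem_mesh =
  fixes \<Omega> :: "(real^'d) set" and T :: "(real^'d) set set"
  assumes dom: "polyhedral_domain \<Omega>" and tri: "triangulation \<Omega> T"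
begin

lemma finite_T: "finite T" using tri by (simp add: triangulation_def)

lemma simplex: "V \<in> T \<Longrightarrow> full_simplex V"
  using tri by (simp add: triangulation_def full_simplex_def)

lemma hull_Int: "V \<in> T \<Longrightarrow> W \<in> T \<Longrightarrow> convex hull V \<inter> convex hull W = convex hull (V \<inter> W)"
  using tri by (simp add: triangulation_def)

lemma closure_eq: "closure \<Omega> = (\<Union>V\<in>T. convex hull V)"
  using tri by (simp add: triangulation_def)

lemma open_dom: "open \<Omega>" and bounded_dom: "bounded \<Omega>"
  and interior_closure_dom: "interior (closure \<Omega>) = \<Omega>"
  using dom by (auto simp: polyhedral_domain_def)

lemma hull_subset_closure: "V \<in> T \<Longrightarrow> convex hull V \<subseteq> closure \<Omega>"
  using closure_eq by blast

text \<open>The domain equals the interior of its closure, so open subsets of cells cannot leave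
  it.\<close>

lemma open_in_hull: "V \<in> T \<Longrightarrow> open B \<Longrightarrow> B \<subseteq> convex hull V \<Longrightarrow> B \<subseteq> \<Omega>"
  using interior_maximal[of B "closure \<Omega>"] hull_subset_closure interior_closure_dom by blast

lemma in_cell: assumes "x \<in> \<Omega>" obtains V where "V \<in> T" "x \<in> convex hull V"
  using assms closure_subset closure_eq by blast

lemma finite_nodes: "finite (interior_nodes \<Omega> T)"
  using finite_T simplex unfolding interior_nodes_def full_simplex_def by blast

lemma bary_cell_agree:
  assumes "V \<in> T" "W \<in> T" "x \<in> convex hull V" "x \<in> convex hull W"
  shows "bary V v x = bary W v x"
  using assms bary_agree simplex hull_Int by (metis IntI)

text \<open>The open star of an interior vertex lies in the domain: dilating a neighbourhood of \<open>x\<close>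
  towards \<open>v\<close> moves it into \<open>\<Omega>\<close>, where it is covered by the cells around \<open>v\<close> that contain the
  dilated \<open>x\<close>; scaling back does not leave these cells.\<close>
lemma open_star:
  assumes v: "v \<in> \<Omega>" and V: "V \<in> T" and x: "x \<in> convex hull V" and pos: "bary V v x > 0"
  shows "x \<in> \<Omega>"
proof -
  interpret V: full_simplex V using V by (rule simplex)
  have vV: "v \<in> V" using V.bary_zero[OF x, of v] pos by auto
  obtain e where e: "e > 0" "ball v e \<subseteq> \<Omega>" using open_dom v openE by blast
  \<comment> \<open>Small enough that \<open>D x\<close> falls into the ball around
    \<open>v\<close>; the summand 1 keeps the denominator positive when x = v.\<close>
  define t where "t = min 1 (e / (norm (x - v) + 1) / 2)"
  have t: "t > 0" "t \<le> 1" using e by (auto simp: t_def add_nonneg_pos)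
  define D where "D = (\<lambda>y. v + t *\<^sub>R (y - v))"
  have "t * norm (x - v) \<le> e / (norm (x - v) + 1) / 2 * norm (x - v)"
    by (intro mult_right_mono) (auto simp: t_def)
  also have "\<dots> < e" using e by (simp add: field_simps add_pos_nonneg add_nonneg_pos)
  finally have "D x \<in> ball v e" using t by (simp add: D_def dist_norm)
  then have Dx: "D x \<in> \<Omega>" using e by blast
  define Ws where "Ws = {W\<in>T. D x \<in> convex hull W}"
  have W: "W \<in> T" "full_simplex W" "v \<in> W" "bary W v x > 0" if "W \<in> Ws" for W
  proof -
    show WT: "W \<in> T" using that by (simp add: Ws_def)
    then show fs: "full_simplex W" by (rule simplex)
    have DxV: "D x \<in> convex hull V"
      using x vV t unfolding V.hull_iff_bary by (auto simp: D_def V.bary_scaled)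
    then have Dxh: "D x \<in> convex hull (V \<inter> W)"
      using hull_Int[OF V WT] that by (auto simp: Ws_def)
    have "bary V v (D x) > 0" using t pos vV by (simp add: D_def V.bary_scaled add_nonneg_pos)
    then show "v \<in> W" using V.bary_zero[OF Dxh, of v] by auto
    have "bary V w x = 0" if "w \<in> V - (V \<inter> W)" for w
    proof -
      have "w \<noteq> v" using that \<open>v \<in> W\<close> by auto
      have "bary V w (D x) = 0" using V.bary_zero[OF Dxh, of w] that by auto
      then show ?thesis using \<open>w \<noteq> v\<close> t vV that by (auto simp: D_def V.bary_scaled)
    qed
    then have "x \<in> convex hull (V \<inter> W)" using V.hull_subset_bary[OF _ x, of "V \<inter> W"] by blast
    then show "bary W v x > 0" using bary_agree[OF simplex[OF V] fs] pos by simp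
  qed
  have finW: "finite Ws" using finite_T by (simp add: Ws_def)
  \<comment> \<open>Removing the finitely many closed cells that miss \<open>D x\<close> leaves a
    neighbourhood of \<open>D x\<close> covered by the cells of \<open>Ws\<close> alone.\<close>
  define U where "U = \<Omega> - (\<Union>W\<in>T - Ws. convex hull W)"
  have "closed (\<Union>W\<in>T - Ws. convex hull W)"
    using finite_T simplex full_simplex.closed_hull by (intro closed_UN) auto
  then have "open U" unfolding U_def using open_dom by (intro open_Diff)
  have "D x \<in> U" using Dx by (auto simp: U_def Ws_def)
  have "continuous_on UNIV D" unfolding D_def by (intro continuous_intros)
  then have o1: "open (D -` U)" using \<open>open U\<close> open_vimage by blast
  define Y where "Y = D -` U \<inter> (\<Inter>W\<in>Ws. bary W v -` {0<..})"
  have "open Y" unfolding Y_def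
    using finW full_simplex.continuous_on_bary[OF W(2)]
    by (intro open_Int o1 open_INT ballI) (auto intro!: open_vimage)
  moreover have "x \<in> Y" using W \<open>D x \<in> U\<close> by (auto simp: Y_def)
  moreover have "Y \<subseteq> closure \<Omega>"
  proof
    fix y assume y: "y \<in> Y"
    then have "D y \<in> \<Omega>" by (auto simp: Y_def U_def)
    then obtain W' where W': "W' \<in> T" "D y \<in> convex hull W'" by (rule in_cell)
    then have "W' \<in> Ws" using y by (auto simp: Y_def U_def)
    interpret W: full_simplex W' using W' by (intro simplex)
    \<comment> \<open>The \<open>v\<close> coordinate is positive by the choice of \<open>Y\<close>;
      the others are those of \<open>D y\<close> divided by \<open>t\<close>.\<close>
    have "bary W' w y \<ge> 0" if "w \<in> W'" for w
    proof (cases "w = v")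
      case True
      then show ?thesis using y \<open>W' \<in> Ws\<close> by (force simp: Y_def)
    next
      case False
      have "bary W' w (D y) \<ge> 0" using W' that W.hull_iff_bary by blast
      then show ?thesis using False that W(3)[OF \<open>W' \<in> Ws\<close>] t
        by (auto simp: D_def W.bary_scaled zero_le_mult_iff)
    qed
    then show "y \<in> closure \<Omega>" using W'(1) hull_subset_closure W.hull_iff_bary by blast
  qed
  ultimately show ?thesis using interior_closure_dom interior_maximal by blast
qed

section \<open>Existence and uniqueness of hat functions\<close>

text \<open>Vertices outside the domain carry the value 0 for both functions, so these agree at all
  vertices of each cell and hence on the cell.\<close>

lemma P1_0_unique:
  assumes "u \<in> P1_0 \<Omega> T" "u' \<in> P1_0 \<Omega> T" "\<And>w. w \<in> interior_nodes \<Omega> T \<Longrightarrow> u w = u' w"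
  shows "u = u'"
proof
  fix x
  show "u x = u' x"
  proof (cases "x \<in> \<Omega>")
    case True
    then obtain V where V: "V \<in> T" "x \<in> convex hull V" by (rule in_cell)
    obtain a b where ab: "\<And>x. x \<in> convex hull V \<Longrightarrow> u x = inner a x + b"
      using assms V unfolding P1_0_def by blast
    obtain a' b' where ab': "\<And>x. x \<in> convex hull V \<Longrightarrow> u' x = inner a' x + b'"
      using assms V unfolding P1_0_def by blast
    have "u w = u' w" if "w \<in> V" for w
      using assms that V by (cases "w \<in> \<Omega>") (auto simp: P1_0_def interior_nodes_def)
    then show ?thesis unfolding ab[OF V(2)] ab'[OF V(2)]
      by (intro affine_eq_on_hull[OF _ V(2)]) (metis ab ab' hull_inc)
  next
    case False
    then show ?thesis using assms by (simp add: P1_0_def)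
  qed
qed

text \<open>Barycentric coordinates of \<open>v\<close>, glued over the cells. They match on common
  faces, and the open star property makes them vanish at cell points outside the domain.\<close>

lemma hat_exists:
  assumes v: "v \<in> interior_nodes \<Omega> T"
  shows "\<exists>u. u \<in> P1_0 \<Omega> T \<and> (\<forall>w\<in>interior_nodes \<Omega> T. u w = (if w = v then 1 else 0))"
proof -
  define u where "u x = (if x \<in> \<Omega> then bary (SOME V. V \<in> T \<and> x \<in> convex hull V) v x else 0)" for x
  have v\<Omega>: "v \<in> \<Omega>" using v by (simp add: interior_nodes_def)
  have u: "u x = bary V v x" if V: "V \<in> T" "x \<in> convex hull V" for x V
  proof (cases "x \<in> \<Omega>")
    case True
    have "(SOME V. V \<in> T \<and> x \<in> convex hull V) \<in> T \<and> x \<in> convex hull (SOME V. V \<in> T \<and> x \<in> convex hull V)"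
      using someI[of "\<lambda>V. V \<in> T \<and> x \<in> convex hull V"] V by auto
    then have "bary (SOME V. V \<in> T \<and> x \<in> convex hull V) v x = bary V v x"
      using V bary_cell_agree by blast
    then show ?thesis using True by (simp add: u_def)
  next
    case False
    interpret V: full_simplex V using V(1) by (rule simplex)
    \<comment> \<open>Nonnegative on the cell, and positive only inside the domain, hence 0
      here.\<close>
    have "bary V v x \<ge> 0"
      using V V.hull_iff_bary V.bary_zero[OF V(2), of v] by (cases "v \<in> V") auto
    moreover have "\<not> bary V v x > 0" using open_star[OF v\<Omega> V] False by auto
    ultimately show ?thesis using False by (simp add: u_def)
  qed
  have "continuous_on (\<Union>V\<in>T. convex hull V) u"
  proof (rule continuous_on_closed_Union[OF finite_T])
    fix V assume V: "V \<in> T"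
    interpret V: full_simplex V using V by (rule simplex)
    show "closed (convex hull V)" by (rule V.closed_hull)
    show "continuous_on (convex hull V) u"
      using V.continuous_on_bary u[OF V] by (metis continuous_on_cong)
  qed
  then have "continuous_on (closure \<Omega>) u" by (simp add: closure_eq)
  moreover have "continuous_on (- \<Omega>) u"
    using continuous_on_const[of "- \<Omega>" "0::real"] by (rule continuous_on_eq) (simp add: u_def)
  \<comment> \<open>Pasting over two closed sets, the closure of the domain and its
    complement.\<close>
  ultimately have "continuous_on (closure \<Omega> \<union> (- \<Omega>)) u"
    using open_dom by (intro continuous_on_closed_Un) auto
  moreover have "closure \<Omega> \<union> (- \<Omega>) = UNIV" using closure_subset by blast
  ultimately have c: "continuous_on UNIV u" by simp
  have "\<exists>a b. \<forall>x\<in>convex hull V. u x = inner a x + b" if "V \<in> T" for V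
    using full_simplex.bary_affine[OF simplex[OF that], of v] u[OF that] by metis
  with c have "u \<in> P1_0 \<Omega> T" by (auto simp: P1_0_def u_def)
  moreover have "u w = (if w = v then 1 else 0)" if "w \<in> interior_nodes \<Omega> T" for w
  proof -
    obtain V where V: "V \<in> T" "w \<in> V" using \<open>w \<in> interior_nodes \<Omega> T\<close> by (auto simp: interior_nodes_def)
    then show ?thesis using u[OF V(1)] full_simplex.bary_vertex[OF simplex[OF V(1)] V(2)] hull_inc by metis
  qed
  ultimately show ?thesis by blast
qed

lemma hat_P1_0: "v \<in> interior_nodes \<Omega> T \<Longrightarrow> hat \<Omega> T v \<in> P1_0 \<Omega> T"
  and hat_node: "v \<in> interior_nodes \<Omega> T \<Longrightarrow> w \<in> interior_nodes \<Omega> T \<Longrightarrow>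
    hat \<Omega> T v w = (if w = v then 1 else 0)"
proof -
  assume v: "v \<in> interior_nodes \<Omega> T"
  have "\<exists>!u. u \<in> P1_0 \<Omega> T \<and> (\<forall>w\<in>interior_nodes \<Omega> T. u w = (if w = v then 1 else 0))"
    using hat_exists[OF v] by (rule ex_ex1I) (auto intro!: P1_0_unique)
  from theI'[OF this]
  show "hat \<Omega> T v \<in> P1_0 \<Omega> T"
    "w \<in> interior_nodes \<Omega> T \<Longrightarrow> hat \<Omega> T v w = (if w = v then 1 else 0)"
    unfolding hat_def by auto
qed

lemma hat_eq_bary:
  assumes v: "v \<in> interior_nodes \<Omega> T" and V: "V \<in> T" "x \<in> convex hull V"
  shows "hat \<Omega> T v x = bary V v x"
proof -
  interpret V: full_simplex V using V(1) by (rule simplex)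
  obtain a b where ab: "\<And>x. bary V v x = inner a x + b" using V.bary_affine[of v] by metis
  obtain a' b' where ab': "\<And>x. x \<in> convex hull V \<Longrightarrow> hat \<Omega> T v x = inner a' x + b'"
    using hat_P1_0[OF v] V unfolding P1_0_def by blast
  have "hat \<Omega> T v w = bary V v w" if "w \<in> V" for w
  proof (cases "w \<in> \<Omega>")
    case True
    then have "w \<in> interior_nodes \<Omega> T" using that V by (auto simp: interior_nodes_def)
    then show ?thesis using V.bary_vertex[OF that] hat_node[OF v] by simp
  next
    case False
    then have "w \<noteq> v" using v by (auto simp: interior_nodes_def)
    then show ?thesis using False hat_P1_0[OF v] V.bary_vertex[OF that] by (auto simp: P1_0_def)
  qed
  then show ?thesis unfolding ab ab'[OF V(2)]
    by (intro affine_eq_on_hull[OF _ V(2)]) (metis ab ab' hull_inc)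
qed

end

section \<open>Bounds for the mass matrix\<close>

text \<open>\<open>A\<close> is a Gram matrix, so its form is the integral of a squared norm. The
  index set \<open>S\<close> covers both uses: a single index for the mass matrix, the coordinate
  directions for the stiffness matrix.\<close>

lemma sesq_gram_has_integral:
  fixes f :: "'k \<Rightarrow> nat \<Rightarrow> 'a::euclidean_space \<Rightarrow> complex"
  assumes int: "\<And>i j. i < n \<Longrightarrow> j < n \<Longrightarrow> (\<lambda>y. \<Sum>k\<in>S. f k i y * cnj (f k j y)) integrable_on \<Omega>"
    and A: "\<And>i j. A j i = integral \<Omega> (\<lambda>y. \<Sum>k\<in>S. f k i y * cnj (f k j y))"
  shows "((\<lambda>y. \<Sum>k\<in>S. (cmod (\<Sum>i<n. x i * f k i y))\<^sup>2) has_integral Re (sesq n A x)) \<Omega>"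
proof -
  have "((\<lambda>y. \<Sum>j<n. \<Sum>i<n. cnj (x j) * x i * (\<Sum>k\<in>S. f k i y * cnj (f k j y)))
      has_integral (\<Sum>j<n. \<Sum>i<n. cnj (x j) * x i * A j i)) \<Omega>"
    unfolding A using int
    by (intro has_integral_sum has_integral_mult_right integrable_integral) auto
  moreover have "(\<Sum>j<n. \<Sum>i<n. cnj (x j) * x i * A j i) = sesq n A x"
    by (simp add: sesq_def sum_distrib_left mult_ac)
  moreover have "(\<Sum>j<n. \<Sum>i<n. cnj (x j) * x i * (\<Sum>k\<in>S. f k i y * cnj (f k j y)))
      = of_real (\<Sum>k\<in>S. (cmod (\<Sum>i<n. x i * f k i y))\<^sup>2)" for y
  proof -
    have "(\<Sum>j<n. \<Sum>i<n. cnj (x j) * x i * (\<Sum>k\<in>S. f k i y * cnj (f k j y)))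
        = (\<Sum>j<n. \<Sum>k\<in>S. \<Sum>i<n. (x i * f k i y) * cnj (x j * f k j y))"
      unfolding sum_distrib_left
      by (intro sum.cong refl) (subst sum.swap, simp add: mult_ac)
    also have "\<dots> = (\<Sum>k\<in>S. (\<Sum>i<n. x i * f k i y) * cnj (\<Sum>j<n. x j * f k j y))"
      unfolding cnj_sum sum_product
      by (rule trans[OF sum.swap], rule sum.cong[OF refl], rule sum.swap)
    finally show ?thesis by (simp add: complex_norm_square[symmetric] del: of_real_power cnj_sum complex_cnj_mult)
  qed
  ultimately have "((\<lambda>y. complex_of_real (\<Sum>k\<in>S. (cmod (\<Sum>i<n. x i * f k i y))\<^sup>2)) has_integral sesq n A x) \<Omega>"
    by simp
  from has_integral_linear[OF this bounded_linear_Re] show ?thesis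
    by (simp add: o_def del: of_real_sum of_real_power)
qed

text \<open>Integrability holds on a box around \<open>\<Omega>\<close>, and extension by zero does
  not change the function.\<close>

lemma integrable_continuous_support:
  fixes f :: "real^'d \<Rightarrow> 'b::banach"
  assumes "bounded \<Omega>" "continuous_on UNIV f" "\<And>x. x \<notin> \<Omega> \<Longrightarrow> f x = 0"
  shows "f integrable_on \<Omega>"
proof -
  obtain a where a: "\<Omega> \<subseteq> cbox (-a) a" using bounded_subset_cbox_symmetric[OF assms(1)] by blast
  have "f integrable_on cbox (-a) a"
    by (intro integrable_continuous continuous_on_subset[OF assms(2)]) simp
  moreover have "f = (\<lambda>x. if x \<in> \<Omega> then f x else 0)" using assms(3) by auto
  ultimately have "(\<lambda>x. if x \<in> \<Omega> then f x else 0) integrable_on cbox (-a) a" by metis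
  then show ?thesis using has_integral_restrict[OF a] unfolding integrable_on_def by metis
qed

section \<open>Finite element functions and their L2 norm\<close>

locale fem_numbering = fem_mesh \<Omega> T for \<Omega> :: "(real^'d) set" and T +
  fixes nd :: "nat \<Rightarrow> real^'d" and n :: nat
  assumes nd: "bij_betw nd {..<n} (interior_nodes \<Omega> T)"
begin

abbreviation "\<phi> i \<equiv> hat \<Omega> T (nd i)"

definition fe_fun :: "(nat \<Rightarrow> complex) \<Rightarrow> real^'d \<Rightarrow> complex" where
  "fe_fun x y = (\<Sum>i<n. x i * complex_of_real (\<phi> i y))"

lemma nd_node: "i < n \<Longrightarrow> nd i \<in> interior_nodes \<Omega> T"
  using nd bij_betwE by blast

lemma phi_cont: "i < n \<Longrightarrow> continuous_on UNIV (\<phi> i)"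
  and phi_outside: "i < n \<Longrightarrow> y \<notin> \<Omega> \<Longrightarrow> \<phi> i y = 0"
  and phi_affine: "i < n \<Longrightarrow> V \<in> T \<Longrightarrow> \<exists>a b. \<forall>x\<in>convex hull V. \<phi> i x = inner a x + b"
  using hat_P1_0[OF nd_node] by (auto simp: P1_0_def)

lemma phi_bary: "i < n \<Longrightarrow> V \<in> T \<Longrightarrow> y \<in> convex hull V \<Longrightarrow> \<phi> i y = bary V (nd i) y"
  using hat_eq_bary[OF nd_node] .

lemma phi_nd: "i < n \<Longrightarrow> j < n \<Longrightarrow> \<phi> i (nd j) = (if i = j then 1 else 0)"
  using hat_node[OF nd_node nd_node, of i j] nd by (auto simp: bij_betw_def inj_on_def)

lemma fe_fun_nd: "j < n \<Longrightarrow> fe_fun x (nd j) = x j"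
  by (simp add: fe_fun_def phi_nd if_distrib[of "\<lambda>z. _ * complex_of_real z"] cong: if_cong)

lemma fe_fun_cont: "continuous_on UNIV (fe_fun x)"
  unfolding fe_fun_def[abs_def]
  by (intro continuous_on_sum continuous_on_mult continuous_on_of_real continuous_on_const)
     (auto simp: phi_cont)

lemma fe_fun_outside: "y \<notin> \<Omega> \<Longrightarrow> fe_fun x y = 0"
  by (simp add: fe_fun_def phi_outside)

lemma phi_ge_0: assumes "i < n" shows "\<phi> i y \<ge> 0"
proof (cases "y \<in> \<Omega>")
  case True
  then obtain V where V: "V \<in> T" "y \<in> convex hull V" by (rule in_cell)
  interpret V: full_simplex V using V(1) by (rule simplex)
  show ?thesis unfolding phi_bary[OF assms V] using V V.hull_iff_bary V.bary_zero[OF V(2), of "nd i"]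
    by (cases "nd i \<in> V") auto
qed (simp add: phi_outside assms)

text \<open>On a cell only barycentric coordinates of its interior nodes are summed. Coordinates of
  boundary vertices are missing, so the sum can drop below 1.\<close>

lemma sum_phi_le_1: "(\<Sum>i<n. \<phi> i y) \<le> 1"
proof (cases "y \<in> \<Omega>")
  case True
  then obtain V where V: "V \<in> T" "y \<in> convex hull V" by (rule in_cell)
  interpret V: full_simplex V using V(1) by (rule simplex)
  have "(\<Sum>i<n. \<phi> i y) = (\<Sum>i<n. bary V (nd i) y)"
    by (intro sum.cong refl) (simp add: phi_bary V)
  also have "\<dots> = (\<Sum>v\<in>interior_nodes \<Omega> T. bary V v y)"
    by (rule sum.reindex_bij_betw[OF nd])
  also have "\<dots> = (\<Sum>v\<in>interior_nodes \<Omega> T \<inter> V. bary V v y)"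
    using finite_nodes V.bary_zero[OF V(2)] by (intro sum.mono_neutral_right) auto
  also have "\<dots> \<le> (\<Sum>v\<in>V. bary V v y)"
    using V.fin V.hull_iff_bary V(2) by (intro sum_mono2) auto
  finally show ?thesis by (simp add: V.bary_repr)
qed (simp add: phi_outside)

text \<open>Extended from the domain to the whole space, so that the integrand can be compared with
  indicators of balls that may leave the domain.\<close>

lemma mass_has_integral:
  "((\<lambda>y. (cmod (fe_fun x y))\<^sup>2) has_integral Re (sesq n (mass_mat \<Omega> T nd) x)) UNIV"
proof -
  have "((\<lambda>y. \<Sum>k\<in>{0::nat}. (cmod (\<Sum>i<n. x i * complex_of_real (\<phi> i y)))\<^sup>2)
      has_integral Re (sesq n (mass_mat \<Omega> T nd) x)) \<Omega>"
  proof (rule sesq_gram_has_integral)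
    fix i j assume ij: "i < n" "j < n"
    show "(\<lambda>y. \<Sum>k\<in>{0::nat}. complex_of_real (\<phi> i y) * cnj (complex_of_real (\<phi> j y))) integrable_on \<Omega>"
      using ij phi_cont phi_outside bounded_dom
      by (intro integrable_continuous_support) (auto intro!: continuous_intros)
  qed (simp add: mass_mat_def l2_inner_def basis_fn_def)
  then have "((\<lambda>y. (cmod (fe_fun x y))\<^sup>2) has_integral Re (sesq n (mass_mat \<Omega> T nd) x)) \<Omega>"
    by (simp add: fe_fun_def)
  then have "((\<lambda>y. if y \<in> \<Omega> then (cmod (fe_fun x y))\<^sup>2 else 0) has_integral Re (sesq n (mass_mat \<Omega> T nd) x)) UNIV"
    by (simp add: has_integral_restrict_UNIV)
  moreover have "(\<lambda>y. if y \<in> \<Omega> then (cmod (fe_fun x y))\<^sup>2 else 0) = (\<lambda>y. (cmod (fe_fun x y))\<^sup>2)"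
    by (auto simp: fe_fun_outside)
  ultimately show ?thesis by simp
qed

text \<open>Cauchy-Schwarz with the weights \<open>\<phi> i y\<close>, each split into two square
  roots, and total weight at most 1.\<close>

lemma norm_fe_fun_le: "(cmod (fe_fun x y))\<^sup>2 \<le> (\<Sum>i<n. (cmod (x i))\<^sup>2 * \<phi> i y)"
proof -
  have "cmod (fe_fun x y) \<le> (\<Sum>i<n. cmod (x i) * \<phi> i y)"
    unfolding fe_fun_def by (rule sum_norm_le) (simp add: norm_mult phi_ge_0)
  then have "(cmod (fe_fun x y))\<^sup>2 \<le> (\<Sum>i<n. cmod (x i) * \<phi> i y)\<^sup>2"
    by (intro power_mono) auto
  also have "\<dots> = (\<Sum>i<n. (cmod (x i) * sqrt (\<phi> i y)) * sqrt (\<phi> i y))\<^sup>2"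
    by (intro arg_cong[of _ _ "\<lambda>z. z\<^sup>2"] sum.cong refl) (simp add: phi_ge_0 mult.assoc)
  also have "\<dots> \<le> (\<Sum>i<n. (cmod (x i) * sqrt (\<phi> i y))\<^sup>2) * (\<Sum>i<n. (sqrt (\<phi> i y))\<^sup>2)"
    by (rule Cauchy_Schwarz_ineq_sum)
  also have "\<dots> = (\<Sum>i<n. (cmod (x i))\<^sup>2 * \<phi> i y) * (\<Sum>i<n. \<phi> i y)"
    by (simp add: power_mult_distrib phi_ge_0)
  also have "\<dots> \<le> (\<Sum>i<n. (cmod (x i))\<^sup>2 * \<phi> i y) * 1"
    by (intro mult_left_mono sum_phi_le_1 sum_nonneg) (simp add: phi_ge_0)
  finally show ?thesis by simp
qed

end

locale fem_quasi_uniform = fem_numbering \<Omega> T nd n for \<Omega> :: "(real^'d) set" and T nd n +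
  fixes \<rho> h :: real
  assumes rho: "\<rho> > 0" and h: "h > 0"
    and diam: "V \<in> T \<Longrightarrow> diameter (convex hull V) \<le> h"
    and inball: "V \<in> T \<Longrightarrow> \<exists>x. ball x (\<rho> * h) \<subseteq> convex hull V"
begin

section \<open>Upper bound for the mass form\<close>

text \<open>Where the hat function is nonzero, point and node share a cell, whose diameter is at
  most \<open>h\<close>.\<close>

lemma phi_le_indicator: assumes "i < n" shows "\<phi> i y \<le> indicator (cball (nd i) h) y"
proof (cases "\<phi> i y = 0")
  case False
  then have "y \<in> \<Omega>" using phi_outside assms by blast
  then obtain V where V: "V \<in> T" "y \<in> convex hull V" by (rule in_cell)
  interpret V: full_simplex V using V(1) by (rule simplex)
  have "nd i \<in> V" using V.bary_zero[OF V(2), of "nd i"] False phi_bary[OF assms V] by auto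
  then have "dist (nd i) y \<le> diameter (convex hull V)"
    using V V.fin by (intro diameter_bounded_bound)
      (auto simp: hull_inc compact_imp_bounded finite_imp_compact_convex_hull)
  then have "y \<in> cball (nd i) h" using diam[OF V(1)] by simp
  then show ?thesis using V.bary_le_1[OF V(2)] phi_bary[OF assms V] by simp
qed simp

text \<open>Integrating the pointwise bounds leaves the volume of a ball of radius \<open>h\<close>,
  so the constant is the volume of the unit ball.\<close>

lemma mass_upper:
  "Re (sesq n (mass_mat \<Omega> T nd) x) \<le> measure lborel (ball (0::real^'d) 1) * h ^ CARD('d) * (\<Sum>i<n. (cmod (x i))\<^sup>2)"
proof -
  have "((\<lambda>y. \<Sum>i<n. (cmod (x i))\<^sup>2 * indicator (cball (nd i) h) y) has_integral
      (\<Sum>i<n. (cmod (x i))\<^sup>2 * measure lebesgue (cball (nd i) h))) UNIV"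
    by (intro has_integral_sum has_integral_mult_right lmeasurable_iff_has_integral[THEN iffD1]
        lmeasurable_cball lmeasurable_ball finite_lessThan)
  then have "Re (sesq n (mass_mat \<Omega> T nd) x) \<le> (\<Sum>i<n. (cmod (x i))\<^sup>2 * measure lebesgue (cball (nd i) h))"
  proof (rule has_integral_le[OF mass_has_integral])
    fix y
    have "(cmod (fe_fun x y))\<^sup>2 \<le> (\<Sum>i<n. (cmod (x i))\<^sup>2 * \<phi> i y)" by (rule norm_fe_fun_le)
    also have "\<dots> \<le> (\<Sum>i<n. (cmod (x i))\<^sup>2 * indicator (cball (nd i) h) y)"
      by (intro sum_mono mult_left_mono phi_le_indicator) auto
    finally show "(cmod (fe_fun x y))\<^sup>2 \<le> (\<Sum>i<n. (cmod (x i))\<^sup>2 * indicator (cball (nd i) h) y)" .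
  qed
  also have "\<dots> = (\<Sum>i<n. (cmod (x i))\<^sup>2 * (h ^ CARD('d) * measure lborel (ball (0::real^'d) 1)))"
    using h by (simp add: content_cball_conv_ball content_ball_conv_unit_ball[of h "nd _"])
  finally show ?thesis by (simp add: sum_distrib_left mult_ac)
qed

section \<open>Lower bound for the mass form\<close>

text \<open>In the denominator, 4 is the square of the factor 2 lost against the largest vertex
  value, and d+1 passes from the maximum over the vertices to their sum.\<close>

lemma cell_ball:
  assumes V: "V \<in> T"
  obtains z where "ball z (\<rho> * h / 4) \<subseteq> convex hull V"
    "\<And>y. y \<in> ball z (\<rho> * h / 4) \<Longrightarrow>
       (\<Sum>w\<in>V. (cmod (fe_fun x w))\<^sup>2) / (4 * (CARD('d) + 1)) \<le> (cmod (fe_fun x y))\<^sup>2"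
proof -
  interpret V: full_simplex V using V by (rule simplex)
  let ?u = "fe_fun x"
  have ne: "V \<noteq> {}" using V.card by auto
  have "Max ((\<lambda>w. cmod (?u w)) ` V) \<in> (\<lambda>w. cmod (?u w)) ` V"
    using V.fin ne by (intro Max_in) auto
  then obtain w0 where w0: "w0 \<in> V" and "cmod (?u w0) = Max ((\<lambda>w. cmod (?u w)) ` V)" by auto
  then have max: "cmod (?u w) \<le> cmod (?u w0)" if "w \<in> V" for w
    using that V.fin by simp
  have sum_le: "(\<Sum>w\<in>V. (cmod (?u w))\<^sup>2) \<le> (CARD('d) + 1) * (cmod (?u w0))\<^sup>2"
  proof -
    have "(\<Sum>w\<in>V. (cmod (?u w))\<^sup>2) \<le> of_nat (card V) * (cmod (?u w0))\<^sup>2"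
      by (rule sum_bounded_above) (simp add: max power_mono)
    then show ?thesis by (simp add: V.card)
  qed
  \<comment> \<open>On a cell the function is the barycentric interpolant of its vertex
    values.\<close>
  have repr: "?u y = (\<Sum>w\<in>V. of_real (bary V w y) * ?u w)" if "y \<in> convex hull V" for y
  proof -
    have "\<phi> i y = (\<Sum>w\<in>V. bary V w y * \<phi> i w)" if "i < n" for i
    proof -
      obtain a b where ab: "\<And>y. y \<in> convex hull V \<Longrightarrow> \<phi> i y = inner a y + b"
        using phi_affine[OF \<open>i < n\<close> V] by blast
      have "\<phi> i y = (\<Sum>w\<in>V. bary V w y * (inner a w + b))"
        unfolding ab[OF \<open>y \<in> convex hull V\<close>] by (rule V.affine_bary)
      also have "\<dots> = (\<Sum>w\<in>V. bary V w y * \<phi> i w)"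
        by (intro sum.cong refl) (simp add: ab hull_inc)
      finally show ?thesis .
    qed
    then have "?u y = (\<Sum>i<n. \<Sum>w\<in>V. of_real (bary V w y) * (x i * of_real (\<phi> i w)))"
      unfolding fe_fun_def by (intro sum.cong refl) (simp add: sum_distrib_left mult_ac)
    also have "\<dots> = (\<Sum>w\<in>V. of_real (bary V w y) * ?u w)"
      unfolding fe_fun_def by (subst sum.swap) (simp add: sum_distrib_left)
    finally show ?thesis .
  qed
  obtain x0 where x0: "ball x0 (\<rho> * h) \<subseteq> convex hull V" using inball[OF V] by blast
  define z where "z = w0 + (1/4) *\<^sub>R (x0 - w0)"
  have near: "y \<in> convex hull V \<and> bary V w0 y \<ge> 3/4" if y: "y \<in> ball z (\<rho> * h / 4)" for y
  proof -
    \<comment> \<open>Undoing the shrinking returns \<open>y\<close> to the inscribed ball, where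
      coordinates are nonnegative; shrinking by 1/4 towards \<open>w0\<close> then adds 3/4 to the
      coordinate of \<open>w0\<close>.\<close>
    define y' where "y' = w0 + 4 *\<^sub>R (y - w0)"
    have yy': "y = w0 + (1/4) *\<^sub>R (y' - w0)" by (simp add: y'_def)
    have "x0 - y' = 4 *\<^sub>R (z - y)" by (simp add: y'_def z_def algebra_simps)
    then have "dist x0 y' = 4 * dist z y" by (simp add: dist_norm)
    then have "y' \<in> ball x0 (\<rho> * h)" using y by simp
    then have "y' \<in> convex hull V" using x0 by blast
    then have nn: "\<And>w. w \<in> V \<Longrightarrow> bary V w y' \<ge> 0" using V.hull_iff_bary by blast
    have eq: "bary V w y = 3/4 * (if w0 = w then 1 else 0) + 1/4 * bary V w y'" if "w \<in> V" for w
      unfolding yy' using V.bary_scaled[OF that w0, of "1/4" y'] by simp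
    then show ?thesis using nn w0 unfolding V.hull_iff_bary by auto
  qed
  have "(\<Sum>w\<in>V. (cmod (?u w))\<^sup>2) / (4 * (CARD('d) + 1)) \<le> (cmod (?u y))\<^sup>2"
    if "y \<in> ball z (\<rho> * h / 4)" for y
  proof -
    let ?b = "\<lambda>w. bary V w y"
    have y: "y \<in> convex hull V" "?b w0 \<ge> 3/4" using near[OF that] by auto
    have nn: "\<And>w. w \<in> V \<Longrightarrow> ?b w \<ge> 0" using y V.hull_iff_bary by blast
    have s1: "(\<Sum>w\<in>V-{w0}. ?b w) = 1 - ?b w0"
      using V.bary_repr(1)[of y] sum.remove[OF V.fin w0, of ?b] by simp
    have "cmod (\<Sum>w\<in>V-{w0}. of_real (?b w) * ?u w) \<le> (\<Sum>w\<in>V-{w0}. ?b w * cmod (?u w0))"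
      by (rule sum_norm_le) (auto simp: norm_mult nn intro!: mult_left_mono max)
    also have "\<dots> = (1 - ?b w0) * cmod (?u w0)" by (simp add: s1 sum_distrib_right[symmetric])
    finally have r: "cmod (\<Sum>w\<in>V-{w0}. of_real (?b w) * ?u w) \<le> (1 - ?b w0) * cmod (?u w0)" .
    have "?u y = of_real (?b w0) * ?u w0 + (\<Sum>w\<in>V-{w0}. of_real (?b w) * ?u w)"
      unfolding repr[OF y(1)] by (rule sum.remove[OF V.fin w0])
    then have "cmod (of_real (?b w0) * ?u w0) \<le> cmod (?u y) + cmod (\<Sum>w\<in>V-{w0}. of_real (?b w) * ?u w)"
      by (metis add_diff_cancel_right' norm_triangle_ineq4)
    then have "?b w0 * cmod (?u w0) \<le> cmod (?u y) + (1 - ?b w0) * cmod (?u w0)"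
      using r nn[OF w0] by (simp add: norm_mult)
    \<comment> \<open>The other vertices contribute at most \<open>1 - ?b w0\<close> times the
      maximum; with \<open>?b w0\<close> at least 3/4 the factor is at least 1/2.\<close>
    then have "(2 * ?b w0 - 1) * cmod (?u w0) \<le> cmod (?u y)" by (simp add: algebra_simps)
    moreover have "1/2 * cmod (?u w0) \<le> (2 * ?b w0 - 1) * cmod (?u w0)"
      using y(2) by (intro mult_right_mono) auto
    ultimately have "1/2 * cmod (?u w0) \<le> cmod (?u y)" by linarith
    then have "(1/2 * cmod (?u w0))\<^sup>2 \<le> (cmod (?u y))\<^sup>2" by (rule power_mono) simp
    then have "(cmod (?u w0))\<^sup>2 / 4 \<le> (cmod (?u y))\<^sup>2" by (simp add: power_mult_distrib power2_eq_square)
    moreover have "(\<Sum>w\<in>V. (cmod (?u w))\<^sup>2) / (4 * (CARD('d) + 1)) \<le> (cmod (?u w0))\<^sup>2 / 4"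
      using sum_le by (simp add: field_simps)
    ultimately show ?thesis by linarith
  qed
  then show ?thesis using that[of z] near by blast
qed

text \<open>Every interior node is a vertex of some cell; shared vertices are counted repeatedly and
  boundary vertices are added, which only enlarges the right side.\<close>

lemma sum_nodes_le: "(\<Sum>i<n. (cmod (x i))\<^sup>2) \<le> (\<Sum>V\<in>T. \<Sum>w\<in>V. (cmod (fe_fun x w))\<^sup>2)"
proof -
  have fin: "\<And>V. V \<in> T \<Longrightarrow> finite V" using simplex full_simplex.fin by blast
  have "(\<Sum>i<n. (cmod (x i))\<^sup>2) = (\<Sum>i<n. (cmod (fe_fun x (nd i)))\<^sup>2)"
    by (intro sum.cong refl) (simp add: fe_fun_nd)
  also have "\<dots> = (\<Sum>v\<in>interior_nodes \<Omega> T. (cmod (fe_fun x v))\<^sup>2)"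
    by (rule sum.reindex_bij_betw[OF nd])
  also have "\<dots> \<le> (\<Sum>p\<in>Sigma T (\<lambda>V. V). (cmod (fe_fun x (snd p)))\<^sup>2)"
    by (rule sum_le_included[where i=snd])
       (use finite_nodes finite_T fin in \<open>auto simp: interior_nodes_def\<close>)
  also have "\<dots> = (\<Sum>V\<in>T. \<Sum>w\<in>V. (cmod (fe_fun x w))\<^sup>2)"
    using finite_T fin by (subst sum.Sigma) (auto simp: case_prod_beta)
  finally show ?thesis .
qed

text \<open>Distinct cells share at most d vertices, and the hull of so few points has empty
  interior.\<close>

lemma disjoint_in_cells:
  assumes "V \<in> T" "W \<in> T" "V \<noteq> W" "open A" "open B" "A \<subseteq> convex hull V" "B \<subseteq> convex hull W"
  shows "A \<inter> B = {}"
proof -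
  interpret V: full_simplex V using assms(1) by (rule simplex)
  interpret W: full_simplex W using assms(2) by (rule simplex)
  have "card (V \<inter> W) < CARD('d) + 1"
  proof (rule ccontr)
    assume "\<not> ?thesis"
    then have "V \<inter> W = V" "V \<inter> W = W"
      using V.card W.card by (intro card_seteq V.fin W.fin; simp)+
    then show False using assms by auto
  qed
  then have "interior (convex hull (V \<inter> W)) = {}"
    using V.fin by (intro empty_interior_convex_hull) auto
  moreover have "A \<inter> B \<subseteq> interior (convex hull (V \<inter> W))"
    using assms hull_Int[OF assms(1,2)] by (intro interior_maximal) auto
  ultimately show ?thesis by blast
qed

text \<open>A step function on the shrunk balls is integrated below |u|^2; their radius
  \<open>\<rho> * h / 4\<close> produces (\<rho>/4)^d h^d.\<close>

lemma mass_lower: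
  "measure lborel (ball (0::real^'d) 1) * (\<rho>/4) ^ CARD('d) / (4 * (CARD('d) + 1)) * h ^ CARD('d) * (\<Sum>i<n. (cmod (x i))\<^sup>2)
   \<le> Re (sesq n (mass_mat \<Omega> T nd) x)"
proof -
  let ?r = "\<rho> * h / 4"
  let ?c = "\<lambda>V. (\<Sum>w\<in>V. (cmod (fe_fun x w))\<^sup>2) / (4 * (CARD('d) + 1))"
  have "\<exists>z. ball z ?r \<subseteq> convex hull V \<and> (\<forall>y\<in>ball z ?r. ?c V \<le> (cmod (fe_fun x y))\<^sup>2)" if "V \<in> T" for V
    by (rule cell_ball[OF that, of x]) blast
  then obtain z where z: "\<And>V. V \<in> T \<Longrightarrow> ball (z V) ?r \<subseteq> convex hull V"
    and zc: "\<And>V y. V \<in> T \<Longrightarrow> y \<in> ball (z V) ?r \<Longrightarrow> ?c V \<le> (cmod (fe_fun x y))\<^sup>2"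
    by metis
  have r: "?r > 0" using rho h by simp
  let ?C = "?r ^ CARD('d) * measure lborel (ball (0::real^'d) 1)"
  have "((\<lambda>y. \<Sum>V\<in>T. ?c V * indicator (ball (z V) ?r) y) has_integral
      (\<Sum>V\<in>T. ?c V * measure lebesgue (ball (z V) ?r))) UNIV"
    using finite_T
    by (intro has_integral_sum has_integral_mult_right lmeasurable_iff_has_integral[THEN iffD1]
        lmeasurable_cball lmeasurable_ball finite_lessThan)
  then have "(\<Sum>V\<in>T. ?c V * measure lebesgue (ball (z V) ?r)) \<le> Re (sesq n (mass_mat \<Omega> T nd) x)"
  proof (rule has_integral_le[OF _ mass_has_integral])
    fix y
    show "(\<Sum>V\<in>T. ?c V * indicator (ball (z V) ?r) y) \<le> (cmod (fe_fun x y))\<^sup>2"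
    proof (cases "\<exists>V\<in>T. y \<in> ball (z V) ?r")
      case True
      then obtain V where V: "V \<in> T" "y \<in> ball (z V) ?r" by blast
      \<comment> \<open>Disjointness leaves one nonzero summand at \<open>y\<close>.\<close>
      have "y \<notin> ball (z W) ?r" if "W \<in> T - {V}" for W
        using disjoint_in_cells[OF V(1) _ _ open_ball open_ball z[OF V(1)] z[of W]] that V(2) by blast
      then have "(\<Sum>V\<in>T. ?c V * indicator (ball (z V) ?r) y) = ?c V"
        using V finite_T by (subst sum.remove[of T V]) auto
      then show ?thesis using zc[OF V] by simp
    next
      case False
      then have "(\<Sum>V\<in>T. ?c V * indicator (ball (z V) ?r) y) = 0"
        by (intro sum.neutral) auto
      then show ?thesis by simp
    qed
  qed
  moreover have "measure lebesgue (ball (z V) ?r) = ?C" for V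
    using content_ball_conv_unit_ball[of ?r "z V"] r by simp
  ultimately have "(\<Sum>V\<in>T. ?c V * ?C) \<le> Re (sesq n (mass_mat \<Omega> T nd) x)" by simp
  moreover have "(\<Sum>V\<in>T. ?c V * ?C) = (\<Sum>V\<in>T. \<Sum>w\<in>V. (cmod (fe_fun x w))\<^sup>2) * (?C / (4 * (CARD('d) + 1)))"
    unfolding sum_distrib_right[of _ T] by (rule sum.cong) simp_all
  moreover have "(\<Sum>i<n. (cmod (x i))\<^sup>2) * (?C / (4 * (CARD('d) + 1))) \<le>
      (\<Sum>V\<in>T. \<Sum>w\<in>V. (cmod (fe_fun x w))\<^sup>2) * (?C / (4 * (CARD('d) + 1)))"
    using r by (intro mult_right_mono sum_nodes_le) auto
  moreover have "(\<Sum>i<n. (cmod (x i))\<^sup>2) * (?C / (4 * (CARD('d) + 1))) =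
    measure lborel (ball (0::real^'d) 1) * (\<rho>/4) ^ CARD('d) / (4 * (CARD('d) + 1)) * h ^ CARD('d) * (\<Sum>i<n. (cmod (x i))\<^sup>2)"
    by (simp add: power_mult_distrib power_divide)
  ultimately show ?thesis by linarith
qed

end

section \<open>Definiteness of the stiffness matrix\<close>

context fem_numbering
begin

lemma frechet_basis_fn:
  assumes "open B" "B \<subseteq> convex hull V" "y \<in> B" and ab: "\<forall>x\<in>convex hull V. \<phi> i x = inner a x + b"
  shows "frechet_derivative (basis_fn \<Omega> T nd i) (at y) = (\<lambda>v. complex_of_real (inner a v))"
proof -
  have "((\<lambda>x. complex_of_real (inner a x + b)) has_derivative (\<lambda>v. complex_of_real (inner a v))) (at y)"
    by (auto intro!: derivative_eq_intros)
  then have "(basis_fn \<Omega> T nd i has_derivative (\<lambda>v. complex_of_real (inner a v))) (at y)"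
    by (rule has_derivative_transform_within_open[OF _ assms(1,3)])
       (use assms in \<open>auto simp: basis_fn_def\<close>)
  then show ?thesis using frechet_derivative_at by metis
qed

abbreviation D\<phi> :: "'d \<Rightarrow> nat \<Rightarrow> real^'d \<Rightarrow> complex" where
  "D\<phi> k i y \<equiv> frechet_derivative (basis_fn \<Omega> T nd i) (at y) (axis k 1)"

text \<open>The integrand is constant in the interior of each cell. On cell frontiers the derivative
  may not exist, but these are negligible.\<close>

lemma grad_product_integrable:
  assumes "i < n" "j < n"
  shows "(\<lambda>y. \<Sum>k\<in>UNIV. D\<phi> k i y * cnj (D\<phi> k j y)) integrable_on \<Omega>"
proof -
  let ?F = "\<lambda>y. \<Sum>k\<in>UNIV. D\<phi> k i y * cnj (D\<phi> k j y)"
  have cell: "?F absolutely_integrable_on (convex hull V)" if V: "V \<in> T" for V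
  proof -
    interpret V: full_simplex V using V by (rule simplex)
    obtain a b where a: "\<forall>x\<in>convex hull V. \<phi> i x = inner a x + b" using phi_affine[OF assms(1) V] by blast
    obtain a' b' where a': "\<forall>x\<in>convex hull V. \<phi> j x = inner a' x + b'" using phi_affine[OF assms(2) V] by blast
    let ?c = "\<Sum>k\<in>UNIV. complex_of_real (inner a (axis k 1)) * cnj (complex_of_real (inner a' (axis k 1)))"
    have "(\<lambda>_. ?c) absolutely_integrable_on (convex hull V)"
      using V.fin by (intro absolutely_integrable_on_const lmeasurable_compact finite_imp_compact_convex_hull)
    then show ?thesis
    proof (rule absolutely_integrable_spike)
      show "negligible (frontier (convex hull V))" by (intro negligible_convex_frontier convex_convex_hull)
      fix y assume "y \<in> convex hull V - frontier (convex hull V)"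
      then have "y \<in> interior (convex hull V)"
        using V.closed_hull by (simp add: frontier_def)
      then show "?F y = ?c"
        using frechet_basis_fn[OF open_interior interior_subset _ a]
          frechet_basis_fn[OF open_interior interior_subset _ a'] by simp
    qed
  qed
  \<comment> \<open>Absolute integrability is carried along because it passes to unions of
    measurable sets and finally to the measurable subset \<open>\<Omega>\<close>.\<close>
  have "?F absolutely_integrable_on (\<Union>V\<in>S. convex hull V)" if "S \<subseteq> T" for S
    using finite_subset[OF that finite_T] that
  proof (induction S rule: finite_induct)
    case (insert V S)
    have meas: "convex hull W \<in> sets lebesgue" if "W \<in> T" for W
      using full_simplex.closed_hull[OF simplex[OF that]] by (simp add: borel_closed sets_completionI_sets)
    then have "(\<Union>W\<in>S. convex hull W) \<in> sets lebesgue"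
      using insert by (intro sets.finite_UN) auto
    then have "?F absolutely_integrable_on (convex hull V \<union> (\<Union>W\<in>S. convex hull W))"
      using insert meas cell by (intro set_integrable_Un) auto
    then show ?case by simp
  qed simp
  then have "?F absolutely_integrable_on (closure \<Omega>)" unfolding closure_eq by blast
  then have "?F absolutely_integrable_on \<Omega>"
    by (rule set_integrable_subset) (use open_dom closure_subset in \<open>auto simp: sets_completionI_sets borel_open\<close>)
  then show ?thesis by (rule set_lebesgue_integral_eq_integral(1))
qed

lemma stiff_has_integral:
  "((\<lambda>y. \<Sum>k\<in>UNIV. (cmod (\<Sum>i<n. x i * D\<phi> k i y))\<^sup>2) has_integral Re (sesq n (stiff_mat \<Omega> T nd) x)) \<Omega>"
  by (rule sesq_gram_has_integral) (auto simp: stiff_mat_def grad_inner_def intro: grad_product_integrable)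

text \<open>The gradient of the function is a constant vector \<open>g\<close> on the cell interior;
  a nonzero \<open>g\<close> would give positive energy on a small ball there. With \<open>g\<close>
  = 0 the affine function has no linear part.\<close>

lemma fe_fun_constant_on_cell:
  assumes zero: "Re (sesq n (stiff_mat \<Omega> T nd) x) = 0" and V: "V \<in> T"
  shows "\<exists>c. \<forall>y\<in>convex hull V. fe_fun x y = c"
proof -
  interpret V: full_simplex V using V by (rule simplex)
  have "\<forall>i. \<exists>a b. i < n \<longrightarrow> (\<forall>y\<in>convex hull V. \<phi> i y = inner a y + b)"
    using phi_affine[OF _ V] by blast
  then obtain a b where ab: "\<And>i. i < n \<Longrightarrow> \<forall>y\<in>convex hull V. \<phi> i y = inner (a i) y + b i"
    by metis
  let ?g = "\<lambda>y. \<Sum>k\<in>UNIV. (cmod (\<Sum>i<n. x i * D\<phi> k i y))\<^sup>2"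
  define g where "g k = (\<Sum>i<n. x i * complex_of_real (inner (a i) (axis k 1)))" for k :: 'd
  let ?s = "\<Sum>k\<in>UNIV. (cmod (g k))\<^sup>2"
  have "interior (convex hull V) \<noteq> {}"
    using V.indep V.card interior_convex_hull_eq_empty[of V] by simp
  then obtain p where "p \<in> interior (convex hull V)" by blast
  then obtain r where r: "r > 0" "ball p r \<subseteq> convex hull V"
    by (metis mem_interior)
  have gs: "?g y = ?s" if "y \<in> ball p r" for y
    unfolding g_def using frechet_basis_fn[OF open_ball r(2) that ab] by simp
  have "ball p r \<subseteq> \<Omega>" using open_in_hull[OF V open_ball r(2)] .
  have I: "((\<lambda>y. ?s * indicator (ball p r) y) has_integral ?s * measure lebesgue (ball p r)) UNIV"
    by (intro has_integral_mult_right lmeasurable_iff_has_integral[THEN iffD1] lmeasurable_ball)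
  have "((\<lambda>y. if y \<in> \<Omega> then ?g y else 0) has_integral 0) UNIV"
    using stiff_has_integral[of x] zero by (simp only: has_integral_restrict_UNIV)
  then have "?s * measure lebesgue (ball p r) \<le> 0"
  proof (rule has_integral_le[OF I])
    fix y
    show "?s * indicator (ball p r) y \<le> (if y \<in> \<Omega> then ?g y else 0)"
    proof (cases "y \<in> ball p r")
      case True
      then have "?g y = ?s" "y \<in> \<Omega>" using gs \<open>ball p r \<subseteq> \<Omega>\<close> by blast+
      then show ?thesis using True by simp
    qed (simp add: sum_nonneg)
  qed
  moreover have "measure lebesgue (ball p r) > 0" using content_ball_pos[OF r(1)] by simp
  ultimately have "?s \<le> 0" by (metis mult_le_0_iff not_le)
  moreover have "?s \<ge> 0" by (intro sum_nonneg) simp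
  ultimately have "?s = 0" by simp
  then have g0: "g k = 0" for k by (simp add: sum_nonneg_eq_0_iff)
  have lin: "(\<Sum>i<n. x i * complex_of_real (inner (a i) y)) = 0" for y
  proof -
    have "inner (a i) y = (\<Sum>k\<in>UNIV. inner (a i) (axis k 1) * vec_nth y k)" for i
      by (simp add: inner_axis) (simp add: inner_vec_def)
    then have "(\<Sum>i<n. x i * complex_of_real (inner (a i) y)) =
       (\<Sum>i<n. \<Sum>k\<in>UNIV. x i * complex_of_real (inner (a i) (axis k 1)) * complex_of_real (vec_nth y k))"
      by (simp add: sum_distrib_left mult.assoc)
    also have "\<dots> = (\<Sum>k\<in>UNIV. g k * complex_of_real (vec_nth y k))"
      unfolding g_def sum_distrib_right by (rule sum.swap)
    finally show ?thesis by (simp add: g0)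
  qed
  have "fe_fun x y = (\<Sum>i<n. x i * complex_of_real (b i))" if "y \<in> convex hull V" for y
  proof -
    have "fe_fun x y = (\<Sum>i<n. x i * complex_of_real (inner (a i) y) + x i * complex_of_real (b i))"
      unfolding fe_fun_def using ab that by (intro sum.cong refl) (simp add: distrib_left)
    then show ?thesis by (simp add: sum.distrib lin)
  qed
  then show ?thesis by blast
qed

text \<open>If the energy vanishes, the continuous function \<open>fe_fun x\<close> takes finitely many values on
  the connected whole space, so it is constant, and it vanishes outside the bounded domain.\<close>
lemma stiff_definite:
  assumes zero: "Re (sesq n (stiff_mat \<Omega> T nd) x) = 0" and i: "i < n"
  shows "x i = 0"
proof -
  obtain c where c: "\<And>V y. V \<in> T \<Longrightarrow> y \<in> convex hull V \<Longrightarrow> fe_fun x y = c V"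
    using fe_fun_constant_on_cell[OF zero] by metis
  have "range (fe_fun x) \<subseteq> insert 0 (c ` T)"
  proof
    fix z assume "z \<in> range (fe_fun x)"
    then obtain y where y: "z = fe_fun x y" by blast
    show "z \<in> insert 0 (c ` T)"
    proof (cases "y \<in> \<Omega>")
      case True
      then obtain V where "V \<in> T" "y \<in> convex hull V" by (rule in_cell)
      then show ?thesis using c y by auto
    qed (simp add: y fe_fun_outside)
  qed
  then have "finite (range (fe_fun x))" using finite_T finite_subset by blast
  moreover have "connected (range (fe_fun x))"
    using fe_fun_cont connected_continuous_image connected_UNIV by blast
  ultimately obtain d where d: "range (fe_fun x) = {d}"
    using connected_finite_iff_sing by blast
  have "\<Omega> \<noteq> UNIV" using bounded_dom not_bounded_UNIV by metis
  then obtain y0 where "y0 \<notin> \<Omega>" by blast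
  then have "d = 0" using d fe_fun_outside by (metis rangeI singletonD)
  then have "fe_fun x (nd i) = 0" using d by (metis rangeI singletonD)
  then show ?thesis using fe_fun_nd[OF i] by simp
qed

text \<open>K x = 0 implies x^* K x = 0, so definiteness gives a trivial kernel.\<close>

lemma stiff_inverse: "is_mat_inv n (stiff_mat \<Omega> T nd) (mat_inv n (stiff_mat \<Omega> T nd))"
proof (rule is_mat_inv_mat_inv)
  fix x i assume "\<And>j. j < n \<Longrightarrow> (\<Sum>i<n. stiff_mat \<Omega> T nd j i * x i) = 0" "i < n"
  then show "x i = 0" by (intro stiff_definite) (simp_all add: sesq_def)
qed

end

section \<open>Inclusion for the field of values\<close>

lemma stiff_hermitian: "stiff_mat \<Omega> T nd i j = cnj (stiff_mat \<Omega> T nd j i)"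
  unfolding stiff_mat_def grad_inner_def integral_cnj by (simp add: mult.commute)

lemma mass_hermitian: "mass_mat \<Omega> T nd i j = cnj (mass_mat \<Omega> T nd j i)"
  unfolding mass_mat_def l2_inner_def integral_cnj by (simp add: mult.commute)

theorem theorem4:
  fixes \<Omega> :: "(real^'d) set" and \<rho> :: real
  assumes "CARD('d) = 2 \<or> CARD('d) = 3"
    and "polyhedral_domain \<Omega>"
    and "\<rho> > 0"
  shows "\<exists>c C. c > 0 \<and> C > 0 \<and>
    (\<forall>T h (\<kappa>::real) (\<sigma>::real) (nd :: nat \<Rightarrow> real^'d) n.
       quasi_uniform_triangulation \<Omega> \<rho> h T \<and> \<sigma> > 0 \<and>
       bij_betw nd {..<n} (interior_nodes \<Omega> T) \<longrightarrow>
       field_of_values n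
         (mat_mul n (mat_mul n (sys_mat \<kappa> \<sigma> \<Omega> T nd) (mat_inv n (stiff_mat \<Omega> T nd)))
            (mass_mat \<Omega> T nd))
       \<subseteq> {z. c * h ^ CARD('d) - \<kappa>\<^sup>2 / \<sigma> * Im z \<le> Re z \<and>
               Re z \<le> C * h ^ CARD('d) - \<kappa>\<^sup>2 / \<sigma> * Im z})"
proof -
  \<comment> \<open>Both constants depend only on the dimension and on \<open>\<rho>\<close>, and
    are fixed before mesh, \<open>h\<close>, \<open>\<kappa>\<close> and \<open>\<sigma>\<close> are
    chosen.\<close>
  define C where "C = measure lborel (ball (0::real^'d) 1)"
  define c where "c = C * (\<rho>/4) ^ CARD('d) / (4 * (CARD('d) + 1))"
  have C: "C > 0" unfolding C_def by (rule content_ball_pos) simp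
  then have c: "c > 0" unfolding c_def using assms(3) by simp
  have "field_of_values n
      (mat_mul n (mat_mul n (sys_mat \<kappa> \<sigma> \<Omega> T nd) (mat_inv n (stiff_mat \<Omega> T nd))) (mass_mat \<Omega> T nd))
    \<subseteq> {z. c * h ^ CARD('d) - \<kappa>\<^sup>2 / \<sigma> * Im z \<le> Re z \<and>
           Re z \<le> C * h ^ CARD('d) - \<kappa>\<^sup>2 / \<sigma> * Im z}"
    if qu: "quasi_uniform_triangulation \<Omega> \<rho> h T" and sig: "\<sigma> > 0"
      and nd: "bij_betw nd {..<n} (interior_nodes \<Omega> T)" for T h \<kappa> \<sigma> nd n
  proof
    fix z assume z: "z \<in> field_of_values n
      (mat_mul n (mat_mul n (sys_mat \<kappa> \<sigma> \<Omega> T nd) (mat_inv n (stiff_mat \<Omega> T nd))) (mass_mat \<Omega> T nd))"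
    interpret fem_quasi_uniform \<Omega> T nd n \<rho> h
      by unfold_locales (use assms qu nd in \<open>auto simp: quasi_uniform_triangulation_def\<close>)
    obtain x where x: "(\<Sum>j<n. (cmod (x j))\<^sup>2) > 0"
      "(Re z + \<kappa>\<^sup>2 / \<sigma> * Im z) * (\<Sum>j<n. (cmod (x j))\<^sup>2) = Re (sesq n (mass_mat \<Omega> T nd) x)"
    proof (rule field_of_values_shifted[OF stiff_hermitian mass_hermitian stiff_inverse _ sig z])
      show "sys_mat \<kappa> \<sigma> \<Omega> T nd j i = stiff_mat \<Omega> T nd j i - of_real (\<kappa>\<^sup>2) * mass_mat \<Omega> T nd j i
          + \<i> * of_real \<sigma> * mass_mat \<Omega> T nd j i" for j i
        by (simp add: sys_mat_def a_form_def stiff_mat_def mass_mat_def)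
    qed (rule that)
    \<comment> \<open>The mass bounds, divided by the positive |x|^2, enclose the Rayleigh quotient
      of the mass matrix.\<close>
    have "c * h ^ CARD('d) * (\<Sum>j<n. (cmod (x j))\<^sup>2) \<le> (Re z + \<kappa>\<^sup>2 / \<sigma> * Im z) * (\<Sum>j<n. (cmod (x j))\<^sup>2)"
      unfolding x(2) c_def C_def by (rule mass_lower)
    then have lower: "c * h ^ CARD('d) \<le> Re z + \<kappa>\<^sup>2 / \<sigma> * Im z"
      using x(1) by (simp only: mult_le_cancel_right_pos)
    have "(Re z + \<kappa>\<^sup>2 / \<sigma> * Im z) * (\<Sum>j<n. (cmod (x j))\<^sup>2) \<le> C * h ^ CARD('d) * (\<Sum>j<n. (cmod (x j))\<^sup>2)"
      unfolding x(2) C_def by (rule mass_upper)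
    then have "Re z + \<kappa>\<^sup>2 / \<sigma> * Im z \<le> C * h ^ CARD('d)"
      using x(1) by (simp only: mult_le_cancel_right_pos)
    with lower show "z \<in> {z. c * h ^ CARD('d) - \<kappa>\<^sup>2 / \<sigma> * Im z \<le> Re z \<and>
        Re z \<le> C * h ^ CARD('d) - \<kappa>\<^sup>2 / \<sigma> * Im z}" by simp
  qed
  with c C show ?thesis by blast
qed

end
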